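(* Let $X_3$ be the split del Pezzo surface of degree $6$ over $\mathbb{Q}$, $Q=[1:1:1]\in X_3(\mathbb{Q})$, $L=\omega_{X_3}^{-1}$, and let $Z=l_1\cup l_2\cup l_3$ be the union of the strict transforms of the lines $x=y$, $y=z$, $x=z$ of $\mathbb{P}^2$. Then $3\in A(Q,X_3\setminus Z)$ and $\alpha(Q,X_3\setminus Z)=3$. In particular, $\alpha_{\mathrm{ess}}(Q)=3$ and $Z$ is the maximal locally accumulating subvariety at $Q$.
   Context: Surface. $X_3$ is the blow-up $\pi:X_3\to\mathbb{P}^2_{\mathbb{Q}}$ at $[1:0:0],[0:1:0],[0:0:1]$. It is identified with the subvariety $u_1u_2u_3=v_1v_2v_3$ of $\mathbb{P}^1\times\mathbb{P}^1\times\mathbb{P}^1$ (with $[u_i:v_i]$ the coordinates on the $i$-th factor), a point $[x:y:z]$ with $xyz\ne0$ corresponding to $([x:y],[y:z],[z:x])$. Points of $X_3$ outside the exceptional divisors are denoted by their image $[x:y:z]$ in $\mathbb{P}^2$. The anticanonical bundle $\omega_{X_3}^{-1}$ is the pullback of $\mathcal{O}(1,1,1)$. Height. $H$ is a Weil height associated with $\omega_{X_3}^{-1}$; outside the exceptional divisors, for integers $x,y,z$, $$H([x:y:z])=\frac{\max(|x|,|y|)\max(|y|,|z|)\max(|x|,|z|)}{\gcd(x,y)\gcd(y,z)\gcd(x,z)}.$$ (The constants below do not depend on the choice of Weil height.) Distance. For $W=([s_i:t_i])_{i=1}^3$ and $V=([x_i:y_i])_{i=1}^3$ in $X_3\subset(\mathbb{P}^1)^3$,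 $$d(W,V)=\sum_{i=1}^3\frac{|s_iy_i-t_ix_i|}{\sqrt{s_i^2+t_i^2}\sqrt{x_i^2+y_i^2}}.$$ Approximation constants. For a (open or closed) subvariety $V$ of $X=X_3$, let $$A(Q,V)=\{\gamma>0:\exists C>0,\ \exists (y_i)\subset V(\mathbb{Q})\setminus\{Q\},\ d(Q,y_i)\to0,\ d(Q,y_i)^\gamma H(y_i)<C\ \forall i\},$$ and $\alpha(Q,V)=\inf A(Q,V)$. The essential approximation constant is $\alpha_{\mathrm{ess}}(Q)=\sup_V\alpha(Q,V)$, where $V$ runs over all (Zariski) open subsets of $X$ with $\inf\{d(Q,y):y\in V(\mathbb{Q})\}=0$. A subvariety $Z$ of $X$ containing $Q$ is called locally accumulating (at $Q$) if $\alpha(Q,W)<\alpha_{\mathrm{ess}}(Q)$ for every nonempty open subset $W$ of $Z$; it is called the maximal locally accumulating subvariety if moreover $\alpha(Q,X\setminus Z)=\alpha_{\mathrm{ess}}(Q)$. *)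

theory Defs
  imports Complex_Main "HOL-Library.Extended_Real"
begin

text \<open>
  Varieties over the rationals are represented by their sets of complex points, cut out by
  polynomials with rational coefficients. In this way a nonempty open subset without rational
  points is still nonempty. The rational points of \<open>V\<close> are the points of \<open>V\<close> having rational
  homogeneous coordinates.
\<close>

section \<open>The projective line\<close>

definition p1_rel :: "complex \<times> complex \<Rightarrow> complex \<times> complex \<Rightarrow> bool" where
  "p1_rel p q \<longleftrightarrow> p \<noteq> (0, 0) \<and> q \<noteq> (0, 0) \<and> fst p * snd q = snd p * fst q"

quotient_type p1 = "complex \<times> complex" / partial: p1_rel
proof (rule part_equivpI)
  show "\<exists>x. p1_rel x x"
    by (rule exI[of _ "(1, 1)"]) (simp add: p1_rel_def)
  show "symp p1_rel"
    by (auto simp: p1_rel_def symp_def mult.commute)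
  show "transp p1_rel"
  proof (rule transpI)
    fix p q r assume pq: "p1_rel p q" and qr: "p1_rel q r"
    obtain a b c d e f where [simp]: "p = (a, b)" "q = (c, d)" "r = (e, f)"
      by (metis surj_pair)
    have h: "a * d = b * c" "c * f = d * e" using pq qr by (auto simp: p1_rel_def)
    have "c * (a * f) = c * (b * e)" "d * (a * f) = d * (b * e)"
      using h by algebra+
    then show "p1_rel p r" using pq qr by (auto simp: p1_rel_def)
  qed
qed

text \<open>The point \<open>[s : t]\<close>; meaningful only for \<open>(s, t) \<noteq> (0, 0)\<close>.\<close>

definition mk_p1 :: "complex \<Rightarrow> complex \<Rightarrow> p1" where
  "mk_p1 s t = abs_p1 (s, t)"

lemma mk_p1_eq_iff:
  assumes "(s, t) \<noteq> (0, 0)" "(x, y) \<noteq> (0, 0)"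
  shows "mk_p1 s t = mk_p1 x y \<longleftrightarrow> s * y = t * x"
  using Quotient3_rel[OF Quotient3_p1, of "(s, t)" "(x, y)"] assms
  by (auto simp: mk_p1_def p1_rel_def mult.commute)

lemma p1_rel_scale:
  assumes "p1_rel p q"
  obtains l where "l \<noteq> 0" "fst q = l * fst p" "snd q = l * snd p"
proof -
  obtain a b c d where [simp]: "p = (a, b)" "q = (c, d)" by (metis surj_pair)
  have h: "a * d = b * c" "(a, b) \<noteq> (0, 0)" "(c, d) \<noteq> (0, 0)"
    using assms by (auto simp: p1_rel_def)
  show thesis
  proof (cases "a = 0")
    case True
    then show thesis using h by (intro that[of "d / b"]) auto
  next
    case False
    then show thesis using h by (intro that[of "c / a"]) (auto simp: field_simps)
  qed
qed

definition rational_p1 :: "p1 set" where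
  "rational_p1 = {mk_p1 s t | s t. s \<in> \<rat> \<and> t \<in> \<rat> \<and> (s, t) \<noteq> (0, 0)}"

lift_definition chord :: "p1 \<Rightarrow> p1 \<Rightarrow> real" is
  "\<lambda>(s, t) (x, y). cmod (s * y - t * x) /
     (sqrt ((cmod s)\<^sup>2 + (cmod t)\<^sup>2) * sqrt ((cmod x)\<^sup>2 + (cmod y)\<^sup>2))"
proof -
  fix p q r u :: "complex \<times> complex"
  assume "p1_rel p q" "p1_rel r u"
  obtain l where l: "l \<noteq> 0" "fst q = l * fst p" "snd q = l * snd p"
    using p1_rel_scale[OF \<open>p1_rel p q\<close>] .
  obtain m where m: "m \<noteq> 0" "fst u = m * fst r" "snd u = m * snd r"
    using p1_rel_scale[OF \<open>p1_rel r u\<close>] .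
  have norm_scale: "sqrt ((cmod (k * a))\<^sup>2 + (cmod (k * b))\<^sup>2) =
      cmod k * sqrt ((cmod a)\<^sup>2 + (cmod b)\<^sup>2)" for k a b :: complex
    by (simp add: norm_mult power_mult_distrib real_sqrt_mult flip: distrib_left)
  have det_scale: "cmod (l * a * (m * d) - l * b * (m * c)) =
      cmod l * cmod m * cmod (a * d - b * c)" for a b c d
    by (simp add: algebra_simps flip: norm_mult)
  show "(case p of (s, t) \<Rightarrow> \<lambda>(x, y). cmod (s * y - t * x) /
      (sqrt ((cmod s)\<^sup>2 + (cmod t)\<^sup>2) * sqrt ((cmod x)\<^sup>2 + (cmod y)\<^sup>2))) r =
    (case q of (s, t) \<Rightarrow> \<lambda>(x, y). cmod (s * y - t * x) /
      (sqrt ((cmod s)\<^sup>2 + (cmod t)\<^sup>2) * sqrt ((cmod x)\<^sup>2 + (cmod y)\<^sup>2))) u"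
    using l m by (simp add: case_prod_unfold norm_scale det_scale)
qed

section \<open>The surface and its Zariski topology\<close>

type_synonym point = "p1 \<times> p1 \<times> p1"

definition X3 :: "point set" where
  "X3 = {(mk_p1 u1 v1, mk_p1 u2 v2, mk_p1 u3 v3) | u1 v1 u2 v2 u3 v3.
     (u1, v1) \<noteq> (0, 0) \<and> (u2, v2) \<noteq> (0, 0) \<and> (u3, v3) \<noteq> (0, 0) \<and>
     u1 * u2 * u3 = v1 * v2 * v3}"

text \<open>
  A pair \<open>((d1, d2, d3), c)\<close> stands for the polynomial of multidegree \<open>(d1, d2, d3)\<close> in the three
  pairs of variables in which \<open>c i j k\<close> is the coefficient of the monomial of degrees
  \<open>i\<close>, \<open>j\<close>, \<open>k\<close> in \<open>s1\<close>, \<open>s2\<close>, \<open>s3\<close>.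
\<close>

type_synonym multiform = "(nat \<times> nat \<times> nat) \<times> (nat \<Rightarrow> nat \<Rightarrow> nat \<Rightarrow> rat)"

fun eval_form :: "multiform \<Rightarrow> complex \<times> complex \<Rightarrow> complex \<times> complex \<Rightarrow> complex \<times> complex \<Rightarrow> complex"
  where
  "eval_form ((d1, d2, d3), c) (s1, t1) (s2, t2) (s3, t3) =
     (\<Sum>i\<le>d1. \<Sum>j\<le>d2. \<Sum>k\<le>d3. of_rat (c i j k) *
        (s1 ^ i * t1 ^ (d1 - i)) * (s2 ^ j * t2 ^ (d2 - j)) * (s3 ^ k * t3 ^ (d3 - k)))"

definition zeros :: "multiform \<Rightarrow> point set" where
  "zeros f = {(mk_p1 s1 t1, mk_p1 s2 t2, mk_p1 s3 t3) | s1 t1 s2 t2 s3 t3.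
     (s1, t1) \<noteq> (0, 0) \<and> (s2, t2) \<noteq> (0, 0) \<and> (s3, t3) \<noteq> (0, 0) \<and>
     eval_form f (s1, t1) (s2, t2) (s3, t3) = 0}"

definition zariski_closed :: "point set \<Rightarrow> bool" where
  "zariski_closed T \<longleftrightarrow> (\<exists>F. T = X3 \<inter> (\<Inter>f\<in>F. zeros f))"

definition zariski_open :: "point set \<Rightarrow> bool" where
  "zariski_open U \<longleftrightarrow> (\<exists>T. zariski_closed T \<and> U = X3 - T)"

definition zariski_open_in :: "point set \<Rightarrow> point set \<Rightarrow> bool" where
  "zariski_open_in Z W \<longleftrightarrow> (\<exists>U. zariski_open U \<and> W = Z \<inter> U)"

definition zariski_closure :: "point set \<Rightarrow> point set" where
  "zariski_closure S = \<Inter> {T. zariski_closed T \<and> S \<subseteq> T}"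

definition rational_points :: "point set \<Rightarrow> point set" where
  "rational_points V = V \<inter> (rational_p1 \<times> rational_p1 \<times> rational_p1)"

section \<open>The blow-up of the plane\<close>

text \<open>
  The three blown-up points are those with two vanishing coordinates. Away from them, \<open>blowup_pt\<close>
  is the inverse of the blow-up morphism.
\<close>

definition non_centre :: "'a::zero \<Rightarrow> 'a \<Rightarrow> 'a \<Rightarrow> bool" where
  "non_centre x y z \<longleftrightarrow> (x, y) \<noteq> (0, 0) \<and> (y, z) \<noteq> (0, 0) \<and> (z, x) \<noteq> (0, 0)"

definition blowup_pt :: "complex \<Rightarrow> complex \<Rightarrow> complex \<Rightarrow> point" where
  "blowup_pt x y z = (mk_p1 x y, mk_p1 y z, mk_p1 z x)"

definition strict_transform :: "(complex \<Rightarrow> complex \<Rightarrow> complex \<Rightarrow> bool) \<Rightarrow> point set" where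
  "strict_transform C = zariski_closure {blowup_pt x y z | x y z. non_centre x y z \<and> C x y z}"

section \<open>Heights and distance\<close>

definition p1_height :: "int \<Rightarrow> int \<Rightarrow> real" where
  "p1_height s t = real_of_int (max \<bar>s\<bar> \<bar>t\<bar>) / real_of_int (gcd s t)"

text \<open>
  A Weil height for the pullback of \<open>O(1,1,1)\<close> is determined up to bounded factors by the product
  of the standard heights on the three projective lines.
\<close>

definition weil_height :: "(point \<Rightarrow> real) \<Rightarrow> bool" where
  "weil_height H \<longleftrightarrow> (\<exists>c C. c > 0 \<and> C > 0 \<and> (\<forall>s1 t1 s2 t2 s3 t3 :: int.
     (s1, t1) \<noteq> (0, 0) \<longrightarrow> (s2, t2) \<noteq> (0, 0) \<longrightarrow> (s3, t3) \<noteq> (0, 0) \<longrightarrow>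
     (let P = (mk_p1 (of_int s1) (of_int t1), mk_p1 (of_int s2) (of_int t2),
               mk_p1 (of_int s3) (of_int t3));
          h = p1_height s1 t1 * p1_height s2 t2 * p1_height s3 t3
      in P \<in> X3 \<longrightarrow> c * h \<le> H P \<and> H P \<le> C * h)))"

text \<open>On the exceptional divisors the choice of the Weil height is left free.\<close>

definition anticanonical_height :: "(point \<Rightarrow> real) \<Rightarrow> bool" where
  "anticanonical_height H \<longleftrightarrow> weil_height H \<and>
     (\<forall>x y z :: int. non_centre x y z \<longrightarrow>
        H (blowup_pt (of_int x) (of_int y) (of_int z)) =
          real_of_int (max \<bar>x\<bar> \<bar>y\<bar> * max \<bar>y\<bar> \<bar>z\<bar> * max \<bar>x\<bar> \<bar>z\<bar>) /
          real_of_int (gcd x y * gcd y z * gcd x z))"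

lemma p1_height_cong:
  assumes "(s, t) \<noteq> (0, 0)" "(x, y) \<noteq> (0, 0)" "s * y = t * x"
  shows "p1_height s t = p1_height x y"
proof -
  have "\<bar>x\<bar> * gcd s t = gcd (x * s) (x * t)" by (simp add: gcd_mult_distrib_int)
  also have "\<dots> = gcd (s * x) (s * y)" using assms(3) by (simp add: mult.commute)
  also have "\<dots> = \<bar>s\<bar> * gcd x y" by (simp add: gcd_mult_distrib_int)
  finally have 1: "\<bar>x\<bar> * gcd s t = \<bar>s\<bar> * gcd x y" .
  have "\<bar>y\<bar> * gcd s t = gcd (y * s) (y * t)" by (simp add: gcd_mult_distrib_int)
  also have "\<dots> = gcd (t * x) (t * y)" using assms(3) by (simp add: mult.commute)
  also have "\<dots> = \<bar>t\<bar> * gcd x y" by (simp add: gcd_mult_distrib_int)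
  finally have 2: "\<bar>y\<bar> * gcd s t = \<bar>t\<bar> * gcd x y" .
  have pos: "gcd s t > 0" "gcd x y > 0" using assms(1,2) by auto
  have "max \<bar>s\<bar> \<bar>t\<bar> * gcd x y = max \<bar>x\<bar> \<bar>y\<bar> * gcd s t"
    using 1 2 pos by (simp add: max_mult_distrib_right)
  then have "real_of_int (max \<bar>s\<bar> \<bar>t\<bar>) * real_of_int (gcd x y) =
      real_of_int (max \<bar>x\<bar> \<bar>y\<bar>) * real_of_int (gcd s t)"
    by (metis of_int_mult)
  moreover have "real_of_int (gcd s t) \<noteq> 0" "real_of_int (gcd x y) \<noteq> 0"
    using pos by linarith+
  ultimately show ?thesis
    unfolding p1_height_def by (simp add: frac_eq_eq)
qed

lemma anticanonical_height_exists: "\<exists>H. anticanonical_height H"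
proof -
  define h where "h p = (SOME r. \<exists>s t :: int. (s, t) \<noteq> (0, 0) \<and>
      p = mk_p1 (of_int s) (of_int t) \<and> r = p1_height s t)" for p
  have h: "h (mk_p1 (of_int s) (of_int t)) = p1_height s t" if st: "(s, t) \<noteq> (0, 0)" for s t :: int
    unfolding h_def
  proof (rule some_equality)
    show "\<exists>s' t' :: int. (s', t') \<noteq> (0, 0) \<and> mk_p1 (of_int s) (of_int t) =
        mk_p1 (of_int s') (of_int t') \<and> p1_height s t = p1_height s' t'"
      using st by blast
  next
    fix r
    assume "\<exists>s' t' :: int. (s', t') \<noteq> (0, 0) \<and> mk_p1 (of_int s) (of_int t) =
        mk_p1 (of_int s') (of_int t') \<and> r = p1_height s' t'"
    then obtain s' t' :: int where *: "(s', t') \<noteq> (0, 0)"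
      "mk_p1 (of_int s) (of_int t) = mk_p1 (of_int s') (of_int t')" "r = p1_height s' t'"
      by blast
    have "(of_int s * of_int t' :: complex) = of_int t * of_int s'"
      using * st by (subst mk_p1_eq_iff[symmetric]) auto
    then have "s * t' = t * s'" by (metis of_int_eq_iff of_int_mult)
    then show "r = p1_height s t" using * st p1_height_cong by metis
  qed
  define H where "H = (\<lambda>(p1, p2, p3). h p1 * h p2 * h p3)"
  have "weil_height H"
    unfolding weil_height_def
    by (intro exI[of _ 1]) (auto simp: H_def h Let_def)
  moreover have "H (blowup_pt (of_int x) (of_int y) (of_int z)) =
      real_of_int (max \<bar>x\<bar> \<bar>y\<bar> * max \<bar>y\<bar> \<bar>z\<bar> * max \<bar>x\<bar> \<bar>z\<bar>) /
      real_of_int (gcd x y * gcd y z * gcd x z)" if "non_centre x y z" for x y z :: int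
  proof -
    have "(x, y) \<noteq> (0, 0)" "(y, z) \<noteq> (0, 0)" "(z, x) \<noteq> (0, 0)"
      using that by (auto simp: non_centre_def)
    then have "H (blowup_pt (of_int x) (of_int y) (of_int z)) =
        p1_height x y * p1_height y z * p1_height z x"
      unfolding H_def blowup_pt_def prod.case by (metis h)
    then show ?thesis
      by (simp only: p1_height_def of_int_mult times_divide_times_eq gcd.commute[of z x]
          max.commute[of "\<bar>z\<bar>" "\<bar>x\<bar>"])
  qed
  ultimately show ?thesis unfolding anticanonical_height_def by blast
qed

definition pdist :: "point \<Rightarrow> point \<Rightarrow> real" where
  "pdist = (\<lambda>(w1, w2, w3) (v1, v2, v3). chord w1 v1 + chord w2 v2 + chord w3 v3)"

section \<open>Approximation constants\<close>

definition approx_set :: "(point \<Rightarrow> real) \<Rightarrow> point \<Rightarrow> point set \<Rightarrow> real set" where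
  "approx_set H Q V = {\<gamma>. \<gamma> > 0 \<and> (\<exists>C>0. \<exists>y :: nat \<Rightarrow> point.
     (\<forall>i. y i \<in> rational_points V - {Q}) \<and>
     (\<lambda>i. pdist Q (y i)) \<longlonglongrightarrow> 0 \<and>
     (\<forall>i. pdist Q (y i) powr \<gamma> * H (y i) < C))}"

definition approx_const :: "(point \<Rightarrow> real) \<Rightarrow> point \<Rightarrow> point set \<Rightarrow> ereal" where
  "approx_const H Q V = (INF \<gamma>\<in>approx_set H Q V. ereal \<gamma>)"

definition ess_approx_const :: "(point \<Rightarrow> real) \<Rightarrow> point \<Rightarrow> ereal" where
  "ess_approx_const H Q =
     (SUP V\<in>{V. zariski_open V \<and> (INF y\<in>rational_points V. ereal (pdist Q y)) = 0}.
        approx_const H Q V)"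

definition locally_accumulating :: "(point \<Rightarrow> real) \<Rightarrow> point \<Rightarrow> point set \<Rightarrow> bool" where
  "locally_accumulating H Q Z \<longleftrightarrow> zariski_closed Z \<and> Q \<in> Z \<and>
     (\<forall>W. zariski_open_in Z W \<and> W \<noteq> {} \<longrightarrow> approx_const H Q W < ess_approx_const H Q)"

definition maximal_locally_accumulating :: "(point \<Rightarrow> real) \<Rightarrow> point \<Rightarrow> point set \<Rightarrow> bool" where
  "maximal_locally_accumulating H Q Z \<longleftrightarrow> locally_accumulating H Q Z \<and>
     approx_const H Q (X3 - Z) = ess_approx_const H Q"

end

theory Submission
  imports Defs "HOL-Computational_Algebra.Polynomial"
begin

text \<open>
  For each pair, \<open>gcd x y\<close> divides \<open>x - y\<close>, so off the diagonals every factor of the height times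
  the corresponding chordal distance to \<open>[1 : 1]\<close> is at least \<open>1 / 2\<close>. Multiplying the three
  inequalities bounds \<open>d\<^sup>3 H\<close> below by \<open>1 / 8\<close> outside \<open>Z\<close>.

  Conversely, the points \<open>[n + p : n + q : n + r]\<close> of a line through \<open>[1 : 1 : 1]\<close> have
  \<open>d = O(1 / n)\<close> and \<open>H = O(n\<^sup>3)\<close>, improving to \<open>O(n\<^sup>2)\<close> on the three lines of \<open>Z\<close>, where one factor
  of \<open>H\<close> is constant. Restricted to such a line with parameter \<open>1 / n\<close>, a form is a polynomial in
  one variable, so an open set meeting the line contains these points for all large \<open>n\<close>. Every
  open set with rational points close to \<open>[1 : 1 : 1]\<close> meets such a line.
\<close>

section \<open>Forms and points\<close>

text \<open>In \<open>eval_form\<close> the exponents of each pair of coordinates sum to the same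
  degree, so every monomial picks up the same power of the scaling factor.\<close>

lemma eval_form_scale:
  "eval_form f (l1 * s1, l1 * t1) (l2 * s2, l2 * t2) (l3 * s3, l3 * t3) =
     l1 ^ fst (fst f) * l2 ^ fst (snd (fst f)) * l3 ^ snd (snd (fst f)) *
     eval_form f (s1, t1) (s2, t2) (s3, t3)"
proof -
  obtain d1 d2 d3 c where f: "f = ((d1, d2, d3), c)"
    by (metis surj_pair)
  have pow: "(l * s) ^ i * (l * t) ^ (d - i) = l ^ d * (s ^ i * t ^ (d - i))"
    if "i \<le> d" for l s t :: complex and i d
    using that by (simp add: power_mult_distrib flip: power_add)
  show ?thesis
    by (auto simp: f sum_distrib_left pow mult_ac intro!: sum.cong)
qed

lemma mk_p1_eq_scale:
  assumes "mk_p1 s t = mk_p1 x y" "(s, t) \<noteq> (0, 0)" "(x, y) \<noteq> (0, 0)"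
  obtains l where "l \<noteq> 0" "x = l * s" "y = l * t"
proof -
  have "p1_rel (s, t) (x, y)"
    using assms mk_p1_eq_iff[OF assms(2,3)] by (simp add: p1_rel_def)
  then show thesis
    using that by (elim p1_rel_scale) auto
qed

lemma mk_p1_diag: "t \<noteq> 0 \<Longrightarrow> mk_p1 t t = mk_p1 1 1"
  by (simp add: mk_p1_eq_iff)

text \<open>\<open>zeros\<close> only asks for some choice of homogeneous coordinates at which the
  form vanishes. Another choice multiplies the value by a nonzero factor, so any coordinates may be
  tested.\<close>

lemma mk_p1_in_zeros_iff:
  assumes "(s1, t1) \<noteq> (0, 0)" "(s2, t2) \<noteq> (0, 0)" "(s3, t3) \<noteq> (0, 0)"
  shows "(mk_p1 s1 t1, mk_p1 s2 t2, mk_p1 s3 t3) \<in> zeros f \<longleftrightarrow>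
    eval_form f (s1, t1) (s2, t2) (s3, t3) = 0"
proof
  assume "(mk_p1 s1 t1, mk_p1 s2 t2, mk_p1 s3 t3) \<in> zeros f"
  then obtain a1 b1 a2 b2 a3 b3 where
    eq: "mk_p1 s1 t1 = mk_p1 a1 b1" "mk_p1 s2 t2 = mk_p1 a2 b2" "mk_p1 s3 t3 = mk_p1 a3 b3" and
    nz: "(a1, b1) \<noteq> (0, 0)" "(a2, b2) \<noteq> (0, 0)" "(a3, b3) \<noteq> (0, 0)" and
    0: "eval_form f (a1, b1) (a2, b2) (a3, b3) = 0"
    unfolding zeros_def by blast
  obtain l1 where l1: "l1 \<noteq> 0" "a1 = l1 * s1" "b1 = l1 * t1"
    using mk_p1_eq_scale[OF eq(1) assms(1) nz(1)] .
  obtain l2 where l2: "l2 \<noteq> 0" "a2 = l2 * s2" "b2 = l2 * t2"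
    using mk_p1_eq_scale[OF eq(2) assms(2) nz(2)] .
  obtain l3 where l3: "l3 \<noteq> 0" "a3 = l3 * s3" "b3 = l3 * t3"
    using mk_p1_eq_scale[OF eq(3) assms(3) nz(3)] .
  show "eval_form f (s1, t1) (s2, t2) (s3, t3) = 0"
    using 0 l1(1) l2(1) l3(1) unfolding l1(2,3) l2(2,3) l3(2,3) eval_form_scale by simp
next
  assume "eval_form f (s1, t1) (s2, t2) (s3, t3) = 0"
  then show "(mk_p1 s1 t1, mk_p1 s2 t2, mk_p1 s3 t3) \<in> zeros f"
    unfolding zeros_def using assms by blast
qed

lemma blowup_pt_in_zeros_iff:
  assumes "non_centre x y z"
  shows "blowup_pt x y z \<in> zeros f \<longleftrightarrow> eval_form f (x, y) (y, z) (z, x) = 0"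
  using assms by (simp add: blowup_pt_def non_centre_def mk_p1_in_zeros_iff)

lemma blowup_pt_scale:
  assumes "k \<noteq> 0" "non_centre x y z"
  shows "blowup_pt (k * x) (k * y) (k * z) = blowup_pt x y z"
  using assms by (auto simp: blowup_pt_def non_centre_def mk_p1_eq_iff)

lemma X3_cases:
  assumes "P \<in> X3"
  obtains u1 v1 u2 v2 u3 v3 where "P = (mk_p1 u1 v1, mk_p1 u2 v2, mk_p1 u3 v3)"
    "(u1, v1) \<noteq> (0, 0)" "(u2, v2) \<noteq> (0, 0)" "(u3, v3) \<noteq> (0, 0)"
    "u1 * u2 * u3 = v1 * v2 * v3"
  using assms unfolding X3_def by blast

text \<open>Both sides of the defining equation have degree one in each pair of coordinates, so
  rescaling multiplies them by the same nonzero factor \<open>l1 * l2 * l3\<close>.\<close>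

lemma mk_p1_in_X3_iff:
  assumes "(s1, t1) \<noteq> (0, 0)" "(s2, t2) \<noteq> (0, 0)" "(s3, t3) \<noteq> (0, 0)"
  shows "(mk_p1 s1 t1, mk_p1 s2 t2, mk_p1 s3 t3) \<in> X3 \<longleftrightarrow> s1 * s2 * s3 = t1 * t2 * t3"
proof
  assume "(mk_p1 s1 t1, mk_p1 s2 t2, mk_p1 s3 t3) \<in> X3"
  then obtain a1 b1 a2 b2 a3 b3 where
    eq: "mk_p1 s1 t1 = mk_p1 a1 b1" "mk_p1 s2 t2 = mk_p1 a2 b2" "mk_p1 s3 t3 = mk_p1 a3 b3" and
    nz: "(a1, b1) \<noteq> (0, 0)" "(a2, b2) \<noteq> (0, 0)" "(a3, b3) \<noteq> (0, 0)" and
    0: "a1 * a2 * a3 = b1 * b2 * b3"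
    by (elim X3_cases) auto
  obtain l1 where l1: "l1 \<noteq> 0" "a1 = l1 * s1" "b1 = l1 * t1"
    using mk_p1_eq_scale[OF eq(1) assms(1) nz(1)] .
  obtain l2 where l2: "l2 \<noteq> 0" "a2 = l2 * s2" "b2 = l2 * t2"
    using mk_p1_eq_scale[OF eq(2) assms(2) nz(2)] .
  obtain l3 where l3: "l3 \<noteq> 0" "a3 = l3 * s3" "b3 = l3 * t3"
    using mk_p1_eq_scale[OF eq(3) assms(3) nz(3)] .
  have "(l1 * l2 * l3) * (s1 * s2 * s3) = (l1 * l2 * l3) * (t1 * t2 * t3)"
    using 0 unfolding l1 l2 l3 by (simp add: mult_ac)
  then show "s1 * s2 * s3 = t1 * t2 * t3"
    using l1(1) l2(1) l3(1) by simp
next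
  assume "s1 * s2 * s3 = t1 * t2 * t3"
  then show "(mk_p1 s1 t1, mk_p1 s2 t2, mk_p1 s3 t3) \<in> X3"
    unfolding X3_def using assms by blast
qed

lemma blowup_pt_in_X3: "non_centre x y z \<Longrightarrow> blowup_pt x y z \<in> X3"
  by (simp add: blowup_pt_def non_centre_def mk_p1_in_X3_iff mult_ac)

section \<open>Forms on affine lines\<close>

text \<open>Substituting a linear polynomial for each of the six coordinates turns the form into a
  polynomial in \<open>t\<close>.\<close>

lemma eval_form_affine_poly:
  "\<exists>p :: complex poly. \<forall>t. eval_form f (a1 + b1 * t, c1 + d1 * t) (a2 + b2 * t, c2 + d2 * t)
     (a3 + b3 * t, c3 + d3 * t) = poly p t"
proof -
  obtain e1 e2 e3 c where f: "f = ((e1, e2, e3), c)"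
    by (metis surj_pair)
  define p where "p = (\<Sum>i\<le>e1. \<Sum>j\<le>e2. \<Sum>k\<le>e3. [:of_rat (c i j k):] *
        ([:a1, b1:] ^ i * [:c1, d1:] ^ (e1 - i)) * ([:a2, b2:] ^ j * [:c2, d2:] ^ (e2 - j)) *
        ([:a3, b3:] ^ k * [:c3, d3:] ^ (e3 - k)))"
  show ?thesis
    by (rule exI[of _ p]) (simp add: f p_def poly_sum mult_ac)
qed

lemma eval_form_affine_finite:
  assumes "eval_form f (a1 + b1 * t0, c1 + d1 * t0) (a2 + b2 * t0, c2 + d2 * t0)
     (a3 + b3 * t0, c3 + d3 * t0) \<noteq> 0"
  shows "finite {t. eval_form f (a1 + b1 * t, c1 + d1 * t) (a2 + b2 * t, c2 + d2 * t)
     (a3 + b3 * t, c3 + d3 * t) = 0}"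
proof -
  obtain p where p: "\<And>t. eval_form f (a1 + b1 * t, c1 + d1 * t) (a2 + b2 * t, c2 + d2 * t)
     (a3 + b3 * t, c3 + d3 * t) = poly p t"
    using eval_form_affine_poly by metis
  with assms have "p \<noteq> 0" by auto
  then show ?thesis unfolding p by (rule poly_roots_finite)
qed

lemma zariski_closed_affine_limit:
  assumes T: "zariski_closed T"
    and sub: "\<And>t. t \<noteq> 0 \<Longrightarrow> (mk_p1 (a1 + b1 * t) (c1 + d1 * t), mk_p1 (a2 + b2 * t) (c2 + d2 * t),
      mk_p1 (a3 + b3 * t) (c3 + d3 * t)) \<in> T"
    and nz: "\<And>t. (a1 + b1 * t, c1 + d1 * t) \<noteq> (0, 0)" "\<And>t. (a2 + b2 * t, c2 + d2 * t) \<noteq> (0, 0)"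
      "\<And>t. (a3 + b3 * t, c3 + d3 * t) \<noteq> (0, 0)"
    and X3: "a1 * a2 * a3 = c1 * c2 * c3"
  shows "(mk_p1 a1 c1, mk_p1 a2 c2, mk_p1 a3 c3) \<in> T"
proof -
  obtain F where F: "T = X3 \<inter> (\<Inter>f\<in>F. zeros f)"
    using T unfolding zariski_closed_def by blast
  have nz0: "(a1, c1) \<noteq> (0, 0)" "(a2, c2) \<noteq> (0, 0)" "(a3, c3) \<noteq> (0, 0)"
    using nz(1)[of 0] nz(2)[of 0] nz(3)[of 0] by simp_all
  have "(mk_p1 a1 c1, mk_p1 a2 c2, mk_p1 a3 c3) \<in> zeros f" if f: "f \<in> F" for f
  proof (rule ccontr)
    assume "(mk_p1 a1 c1, mk_p1 a2 c2, mk_p1 a3 c3) \<notin> zeros f"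
    then have "eval_form f (a1 + b1 * 0, c1 + d1 * 0) (a2 + b2 * 0, c2 + d2 * 0)
        (a3 + b3 * 0, c3 + d3 * 0) \<noteq> 0"
      using mk_p1_in_zeros_iff[OF nz0] by simp
    from eval_form_affine_finite[OF this]
    have "finite {t. eval_form f (a1 + b1 * t, c1 + d1 * t) (a2 + b2 * t, c2 + d2 * t)
       (a3 + b3 * t, c3 + d3 * t) = 0}" .
    moreover have "- {0} \<subseteq> {t. eval_form f (a1 + b1 * t, c1 + d1 * t) (a2 + b2 * t, c2 + d2 * t)
       (a3 + b3 * t, c3 + d3 * t) = 0}"
      using sub f mk_p1_in_zeros_iff[OF nz] unfolding F by auto
    ultimately have "finite (- {0 :: complex})"
      by (rule rev_finite_subset)
    then show False
      using infinite_UNIV_char_0[where 'a = complex] by (simp add: Compl_eq_Diff_UNIV)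
  qed
  then show ?thesis
    unfolding F using nz0 X3 by (simp add: mk_p1_in_X3_iff)
qed

section \<open>The accumulating curves\<close>

text \<open>The expansion of \<open>(s1 - t1) * (s2 - t2) * (s3 - t3)\<close>: the sign is given by
  the number \<open>3 - (i + j + k)\<close> of factors \<open>t\<close>, which has the parity of
  \<open>i + j + k + 1\<close>.\<close>

definition diagonal_form :: multiform where
  "diagonal_form = ((1, 1, 1), \<lambda>i j k. (- 1) ^ (i + j + k + 1))"

lemma eval_diagonal_form:
  "eval_form diagonal_form (s1, t1) (s2, t2) (s3, t3) = (s1 - t1) * (s2 - t2) * (s3 - t3)"
  by (simp add: diagonal_form_def algebra_simps of_rat_minus)

lemma closure_subset: "S \<subseteq> zariski_closure S"
  unfolding zariski_closure_def by blast

lemma closure_minimal: "zariski_closed T \<Longrightarrow> S \<subseteq> T \<Longrightarrow> zariski_closure S \<subseteq> T"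
  unfolding zariski_closure_def by blast

lemma blowup_pt_in_strict_transform:
  "non_centre x y z \<Longrightarrow> C x y z \<Longrightarrow> blowup_pt x y z \<in> strict_transform C"
  unfolding strict_transform_def by (rule subsetD[OF closure_subset]) blast

lemma zariski_closed_zeros: "zariski_closed (X3 \<inter> zeros f)"
  unfolding zariski_closed_def by (rule exI[of _ "{f}"]) simp

text \<open>The pair \<open>(a, b)\<close> parametrises the whole curve. For nonzero
  \<open>a\<close> the point is \<open>blowup_pt a a b\<close>; for \<open>a = 0\<close> it lies
  over the blown-up point [0:0:1] and is obtained as a limit.\<close>

lemma strict_transform_xy:
  assumes "(a, b) \<noteq> (0, 0)"
  shows "(mk_p1 1 1, mk_p1 a b, mk_p1 b a) \<in> strict_transform (\<lambda>x y z. x = y)"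
proof (cases "a = 0")
  case True
  have "(mk_p1 1 1, mk_p1 0 1, mk_p1 1 0) \<in> T"
    if T: "zariski_closed T" and sub: "{blowup_pt x y z | x y z. non_centre x y z \<and> x = y} \<subseteq> T" for T
  \<comment> \<open>The family is [t:t:1] as \<open>t\<close> tends to 0. Its first factor [t:t] is
    rewritten as [1:1], so that the coordinates do not both vanish at \<open>t = 0\<close>.\<close>
  proof (rule zariski_closed_affine_limit[OF T, of 1 0 1 0 0 1 1 0 1 0 0 1])
    fix t :: complex assume t: "t \<noteq> 0"
    have "blowup_pt t t 1 \<in> T"
      using sub t by (force simp: non_centre_def)
    then show "(mk_p1 (1 + 0 * t) (1 + 0 * t), mk_p1 (0 + 1 * t) (1 + 0 * t),
        mk_p1 (1 + 0 * t) (0 + 1 * t)) \<in> T"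
      by (simp add: blowup_pt_def mk_p1_diag[OF t])
  qed auto
  then have "(mk_p1 1 1, mk_p1 0 1, mk_p1 1 0) \<in> strict_transform (\<lambda>x y z. x = y)"
    unfolding strict_transform_def zariski_closure_def by blast
  moreover have "mk_p1 a b = mk_p1 0 1" "mk_p1 b a = mk_p1 1 0"
    using True assms by (auto simp: mk_p1_eq_iff)
  ultimately show ?thesis by simp
next
  case False
  then have "blowup_pt a a b \<in> strict_transform (\<lambda>x y z. x = y)"
    by (intro blowup_pt_in_strict_transform) (auto simp: non_centre_def)
  then show ?thesis
    by (simp add: blowup_pt_def mk_p1_diag[OF False])
qed

text \<open>Here \<open>a = 0\<close> is the point over [1:0:0], the limit of [1:t:t].\<close>

lemma strict_transform_yz:
  assumes "(a, b) \<noteq> (0, 0)"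
  shows "(mk_p1 b a, mk_p1 1 1, mk_p1 a b) \<in> strict_transform (\<lambda>x y z. y = z)"
proof (cases "a = 0")
  case True
  have "(mk_p1 1 0, mk_p1 1 1, mk_p1 0 1) \<in> T"
    if T: "zariski_closed T" and sub: "{blowup_pt x y z | x y z. non_centre x y z \<and> y = z} \<subseteq> T" for T
  proof (rule zariski_closed_affine_limit[OF T, of 1 0 0 1 1 0 1 0 0 1 1 0])
    fix t :: complex assume t: "t \<noteq> 0"
    have "blowup_pt 1 t t \<in> T"
      using sub t by (force simp: non_centre_def)
    then show "(mk_p1 (1 + 0 * t) (0 + 1 * t), mk_p1 (1 + 0 * t) (1 + 0 * t),
        mk_p1 (0 + 1 * t) (1 + 0 * t)) \<in> T"
      by (simp add: blowup_pt_def mk_p1_diag[OF t])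
  qed auto
  then have "(mk_p1 1 0, mk_p1 1 1, mk_p1 0 1) \<in> strict_transform (\<lambda>x y z. y = z)"
    unfolding strict_transform_def zariski_closure_def by blast
  moreover have "mk_p1 a b = mk_p1 0 1" "mk_p1 b a = mk_p1 1 0"
    using True assms by (auto simp: mk_p1_eq_iff)
  ultimately show ?thesis by simp
next
  case False
  then have "blowup_pt b a a \<in> strict_transform (\<lambda>x y z. y = z)"
    by (intro blowup_pt_in_strict_transform) (auto simp: non_centre_def)
  then show ?thesis
    by (simp add: blowup_pt_def mk_p1_diag[OF False])
qed

text \<open>Here \<open>a = 0\<close> is the point over [0:1:0], the limit of [t:1:t].\<close>

lemma strict_transform_xz:
  assumes "(a, b) \<noteq> (0, 0)"
  shows "(mk_p1 a b, mk_p1 b a, mk_p1 1 1) \<in> strict_transform (\<lambda>x y z. x = z)"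
proof (cases "a = 0")
  case True
  have "(mk_p1 0 1, mk_p1 1 0, mk_p1 1 1) \<in> T"
    if T: "zariski_closed T" and sub: "{blowup_pt x y z | x y z. non_centre x y z \<and> x = z} \<subseteq> T" for T
  proof (rule zariski_closed_affine_limit[OF T, of 0 1 1 0 1 0 0 1 1 0 1 0])
    fix t :: complex assume t: "t \<noteq> 0"
    have "blowup_pt t 1 t \<in> T"
      using sub t by (force simp: non_centre_def)
    then show "(mk_p1 (0 + 1 * t) (1 + 0 * t), mk_p1 (1 + 0 * t) (0 + 1 * t),
        mk_p1 (1 + 0 * t) (1 + 0 * t)) \<in> T"
      by (simp add: blowup_pt_def mk_p1_diag[OF t])
  qed auto
  then have "(mk_p1 0 1, mk_p1 1 0, mk_p1 1 1) \<in> strict_transform (\<lambda>x y z. x = z)"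
    unfolding strict_transform_def zariski_closure_def by blast
  moreover have "mk_p1 a b = mk_p1 0 1" "mk_p1 b a = mk_p1 1 0"
    using True assms by (auto simp: mk_p1_eq_iff)
  ultimately show ?thesis by simp
next
  case False
  then have "blowup_pt a b a \<in> strict_transform (\<lambda>x y z. x = z)"
    by (intro blowup_pt_in_strict_transform) (auto simp: non_centre_def)
  then show ?thesis
    by (simp add: blowup_pt_def mk_p1_diag[OF False])
qed

text \<open>One inclusion is minimality of the closure. For the other, a vanishing factor makes one
  coordinate [1:1], and the equation of \<open>X3\<close> then makes the remaining two coordinates
  inverse to each other, which is the parametrisation of one of the three curves.\<close>

lemma strict_transforms_eq_zeros:
  "strict_transform (\<lambda>x y z. x = y) \<union> strict_transform (\<lambda>x y z. y = z) \<union>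
    strict_transform (\<lambda>x y z. x = z) = X3 \<inter> zeros diagonal_form" (is "?Z = _")
proof
  have "strict_transform C \<subseteq> X3 \<inter> zeros diagonal_form"
    if "\<And>x y z. C x y z \<Longrightarrow> x = y \<or> y = z \<or> x = z" for C
    unfolding strict_transform_def
  proof (intro closure_minimal zariski_closed_zeros subsetI)
    fix P assume "P \<in> {blowup_pt x y z | x y z. non_centre x y z \<and> C x y z}"
    then obtain x y z where P: "P = blowup_pt x y z" "non_centre x y z" "C x y z"
      by blast
    then show "P \<in> X3 \<inter> zeros diagonal_form"
      using that[OF P(3)] by (auto simp: blowup_pt_in_X3 blowup_pt_in_zeros_iff eval_diagonal_form)
  qed
  then show "?Z \<subseteq> X3 \<inter> zeros diagonal_form"
    by (intro Un_least) simp_all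
next
  show "X3 \<inter> zeros diagonal_form \<subseteq> ?Z"
  proof
    fix P assume P: "P \<in> X3 \<inter> zeros diagonal_form"
    then obtain u1 v1 u2 v2 u3 v3 where eq: "P = (mk_p1 u1 v1, mk_p1 u2 v2, mk_p1 u3 v3)" and
      nz: "(u1, v1) \<noteq> (0, 0)" "(u2, v2) \<noteq> (0, 0)" "(u3, v3) \<noteq> (0, 0)" and
      rel: "u1 * u2 * u3 = v1 * v2 * v3"
      by (elim IntE X3_cases)
    from P have "(u1 - v1) * (u2 - v2) * (u3 - v3) = 0"
      unfolding eq using mk_p1_in_zeros_iff[OF nz] eval_diagonal_form by auto
    then consider "u1 = v1" | "u2 = v2" | "u3 = v3" by auto
    then show "P \<in> ?Z"
    proof cases
      case 1
      then have "P = (mk_p1 1 1, mk_p1 u2 v2, mk_p1 v2 u2)"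
        unfolding eq using nz rel by (auto simp: mk_p1_eq_iff mult_ac)
      then show ?thesis using strict_transform_xy[OF nz(2)] by simp
    next
      case 2
      then have "P = (mk_p1 v3 u3, mk_p1 1 1, mk_p1 u3 v3)"
        unfolding eq using nz rel by (auto simp: mk_p1_eq_iff mult_ac)
      then show ?thesis using strict_transform_yz[OF nz(3)] by simp
    next
      case 3
      then have "P = (mk_p1 u1 v1, mk_p1 v1 u1, mk_p1 1 1)"
        unfolding eq using nz rel by (auto simp: mk_p1_eq_iff mult_ac)
      then show ?thesis using strict_transform_xz[OF nz(1)] by simp
    qed
  qed
qed

section \<open>Distance and height\<close>

lemma chord_nonneg: "chord p q \<ge> 0"
  by transfer auto

lemma pdist_nonneg: "pdist P P' \<ge> 0"
  by (auto simp: pdist_def case_prod_unfold intro!: add_nonneg_nonneg chord_nonneg)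

lemma chord_mk_p1:
  assumes "(s, t) \<noteq> (0, 0)" "(x, y) \<noteq> (0, 0)"
  shows "chord (mk_p1 s t) (mk_p1 x y) = cmod (s * y - t * x) /
     (sqrt ((cmod s)\<^sup>2 + (cmod t)\<^sup>2) * sqrt ((cmod x)\<^sup>2 + (cmod y)\<^sup>2))"
  using chord.abs_eq[of "(s, t)" "(x, y)"] assms by (simp add: mk_p1_def p1_rel_def mult.commute)

lemma chord_one_int:
  assumes "(s, t) \<noteq> (0 :: int, 0 :: int)"
  shows "chord (mk_p1 1 1) (mk_p1 (of_int s) (of_int t)) =
    \<bar>real_of_int (s - t)\<bar> / (sqrt 2 * sqrt ((real_of_int s)\<^sup>2 + (real_of_int t)\<^sup>2))"
proof -
  have "cmod (of_int t - of_int s) = \<bar>real_of_int (s - t)\<bar>"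
    by (metis abs_minus_commute norm_of_int of_int_abs of_int_diff)
  then show ?thesis
    using assms by (subst chord_mk_p1) simp_all
qed

lemma chord_one_int_le:
  assumes "s > 0"
  shows "chord (mk_p1 1 1) (mk_p1 (of_int s) (of_int t)) \<le> \<bar>real_of_int (s - t)\<bar> / real_of_int s"
proof -
  have "1 * real_of_int s \<le> sqrt 2 * sqrt ((real_of_int s)\<^sup>2 + (real_of_int t)\<^sup>2)"
    using assms by (intro mult_mono real_le_rsqrt) auto
  then show ?thesis
    using assms by (subst chord_one_int) (auto intro!: divide_left_mono mult_pos_pos add_pos_nonneg)
qed

text \<open>Both squares under the root are at most \<open>m\<^sup>2\<close>, so the denominator of
  the chord is at most \<open>2 * m\<close>.\<close>

lemma chord_one_int_ge:
  assumes "(s, t) \<noteq> (0, 0)"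
  shows "chord (mk_p1 1 1) (mk_p1 (of_int s) (of_int t)) \<ge>
    \<bar>real_of_int (s - t)\<bar> / (2 * real_of_int (max \<bar>s\<bar> \<bar>t\<bar>))"
proof -
  define m where "m = real_of_int (max \<bar>s\<bar> \<bar>t\<bar>)"
  have m: "\<bar>real_of_int s\<bar> \<le> m" "\<bar>real_of_int t\<bar> \<le> m"
    unfolding m_def by linarith+
  have pos: "(real_of_int s)\<^sup>2 + (real_of_int t)\<^sup>2 > 0"
    using assms by (auto simp: sum_power2_gt_zero_iff)
  have "(real_of_int s)\<^sup>2 \<le> m\<^sup>2" "(real_of_int t)\<^sup>2 \<le> m\<^sup>2"
    using m by (metis abs_ge_zero power2_abs power_mono)+
  then have "sqrt 2 * sqrt ((real_of_int s)\<^sup>2 + (real_of_int t)\<^sup>2) \<le> 2 * m"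
    using m unfolding real_sqrt_mult[symmetric]
    by (intro real_le_lsqrt) (auto simp: power_mult_distrib)
  moreover have "sqrt 2 * sqrt ((real_of_int s)\<^sup>2 + (real_of_int t)\<^sup>2) > 0"
    using pos by simp
  ultimately show ?thesis
    using assms unfolding m_def[symmetric]
    by (subst chord_one_int) (auto intro!: divide_left_mono mult_pos_pos)
qed

lemma p1_height_ge_1: "(s, t) \<noteq> (0, 0) \<Longrightarrow> p1_height s t \<ge> 1"
proof -
  assume st: "(s, t) \<noteq> (0, 0)"
  have "gcd s t \<le> max \<bar>s\<bar> \<bar>t\<bar>"
  proof (cases "s = 0")
    case False
    then show ?thesis using zdvd_imp_le[of "gcd s t" "\<bar>s\<bar>"] by auto
  qed simp
  moreover have "gcd s t > 0" using st by auto
  ultimately show ?thesis unfolding p1_height_def by (simp del: of_int_max)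
qed

lemma p1_height_le:
  assumes "(s, t) \<noteq> (0, 0)"
  shows "p1_height s t \<le> real_of_int (max \<bar>s\<bar> \<bar>t\<bar>)"
proof -
  have "gcd s t > 0" using assms by auto
  then have "1 \<le> real_of_int (gcd s t)" by linarith
  then have "real_of_int (max \<bar>s\<bar> \<bar>t\<bar>) / real_of_int (gcd s t) \<le> real_of_int (max \<bar>s\<bar> \<bar>t\<bar>) / 1"
    by (intro divide_left_mono) auto
  then show ?thesis unfolding p1_height_def by simp
qed

lemma p1_height_diag: "s \<noteq> 0 \<Longrightarrow> p1_height s s = 1"
  by (simp add: p1_height_def)

text \<open>Liouville's inequality at [1:1]: the maximum in the lower bound for the chord cancels
  the numerator of the height, and the gcd in its denominator is absorbed by the nonzero difference
  \<open>s - t\<close>, which it divides.\<close>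

lemma chord_height_ge:
  assumes "s \<noteq> t"
  shows "chord (mk_p1 1 1) (mk_p1 (of_int s) (of_int t)) * p1_height s t \<ge> 1 / 2"
proof -
  define m where "m = real_of_int (max \<bar>s\<bar> \<bar>t\<bar>)"
  define g where "g = real_of_int (gcd s t)"
  have st: "(s, t) \<noteq> (0, 0)" using assms by auto
  have m: "m > 0" using assms unfolding m_def by (cases "s = 0") (auto simp: less_max_iff_disj)
  have g: "g > 0" using st unfolding g_def by auto
  have "gcd s t \<le> \<bar>s - t\<bar>"
    using assms by (intro zdvd_imp_le) (auto simp: dvd_diff)
  then have "g \<le> \<bar>real_of_int (s - t)\<bar>"
    unfolding g_def by linarith
  then have "g / (2 * m) \<le> chord (mk_p1 1 1) (mk_p1 (of_int s) (of_int t))"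
    using chord_one_int_ge[OF st] m unfolding m_def[symmetric]
    by (meson divide_right_mono less_imp_le mult_pos_pos order_trans zero_less_numeral)
  then have "g / (2 * m) * (m / g) \<le> chord (mk_p1 1 1) (mk_p1 (of_int s) (of_int t)) * (m / g)"
    using m g by (intro mult_right_mono) auto
  then show ?thesis
    using m g unfolding p1_height_def m_def[symmetric] g_def[symmetric] by simp
qed

text \<open>Pairs each factor of the height with the chord in the same projective line.\<close>

lemma anticanonical_height_eq:
  assumes "anticanonical_height H" "non_centre x y z"
  shows "H (blowup_pt (of_int x) (of_int y) (of_int z)) =
    p1_height x y * p1_height y z * p1_height z x"
  using assms unfolding anticanonical_height_def
  by (simp only: p1_height_def of_int_mult times_divide_times_eq gcd.commute[of z x]
      max.commute[of "\<bar>z\<bar>" "\<bar>x\<bar>"])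

lemma pdist_blowup:
  "pdist (blowup_pt 1 1 1) (blowup_pt x y z) =
    chord (mk_p1 1 1) (mk_p1 x y) + chord (mk_p1 1 1) (mk_p1 y z) + chord (mk_p1 1 1) (mk_p1 z x)"
  by (simp add: pdist_def blowup_pt_def)

lemma pdist_height_ge:
  assumes "anticanonical_height H" "x \<noteq> y" "y \<noteq> z" "z \<noteq> x"
  shows "(pdist (blowup_pt 1 1 1) (blowup_pt (of_int x) (of_int y) (of_int z))) ^ 3 *
    H (blowup_pt (of_int x) (of_int y) (of_int z)) \<ge> 1 / 8"
proof -
  define c where "c s t = chord (mk_p1 1 1) (mk_p1 (of_int s) (of_int t))" for s t
  have nc: "non_centre x y z" using assms by (auto simp: non_centre_def)
  have nz: "(x, y) \<noteq> (0, 0)" "(y, z) \<noteq> (0, 0)" "(z, x) \<noteq> (0, 0)" using assms by auto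
  have c0: "c x y \<ge> 0" "c y z \<ge> 0" "c z x \<ge> 0"
    unfolding c_def by (rule chord_nonneg)+
  have h0: "p1_height x y \<ge> 0" "p1_height y z \<ge> 0" "p1_height z x \<ge> 0"
    using nz[THEN p1_height_ge_1] by linarith+
  have c: "c x y * p1_height x y \<ge> 1 / 2" "c y z * p1_height y z \<ge> 1 / 2"
    "c z x * p1_height z x \<ge> 1 / 2"
    unfolding c_def by (rule chord_height_ge; rule assms)+
  have "1 / 8 = (1 / 2) * (1 / 2) * (1 / 2 :: real)" by simp
  also have "\<dots> \<le> (c x y * p1_height x y) * (c y z * p1_height y z) * (c z x * p1_height z x)"
    using c c0 h0 by (intro mult_mono) auto
  also have "\<dots> = (c x y * c y z * c z x) * (p1_height x y * p1_height y z * p1_height z x)"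
    by (simp add: mult_ac)
  \<comment> \<open>Each chord is at most the sum of the three.\<close>
  also have "\<dots> \<le> ((c x y + c y z + c z x) ^ 3) * (p1_height x y * p1_height y z * p1_height z x)"
    unfolding power3_eq_cube using c0 h0 by (intro mult_right_mono mult_mono) auto
  finally show ?thesis
    unfolding anticanonical_height_eq[OF assms(1) nc] pdist_blowup c_def .
qed

section \<open>Rational points near the base point\<close>

lemma rational_p1_int:
  assumes "p \<in> rational_p1"
  obtains s t :: int where "(s, t) \<noteq> (0, 0)" "p = mk_p1 (of_int s) (of_int t)"
proof -
  obtain u v where u: "u \<in> \<rat>" and v: "v \<in> \<rat>" and nz: "(u, v) \<noteq> (0, 0)" and p: "p = mk_p1 u v"
    using assms unfolding rational_p1_def by blast
  obtain a b where ab: "b > 0" "u = of_int a / of_int b" using u by (rule Rats_cases') auto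
  obtain c d where cd: "d > 0" "v = of_int c / of_int d" using v by (rule Rats_cases') auto
  show thesis
  proof (rule that)
    show "(a * d, c * b) \<noteq> (0, 0)" using ab cd nz by auto
    then show "p = mk_p1 (of_int (a * d)) (of_int (c * b))"
      unfolding p using ab cd nz by (subst mk_p1_eq_iff) auto
  qed
qed

text \<open>A point of the projective line with a vanishing coordinate has chord at least 1/2 to
  [1:1]. Hence a point this close to the base point avoids the exceptional divisors and has nonzero
  plane coordinates.\<close>

lemma near_point_int:
  assumes V: "V \<subseteq> X3" and P: "P \<in> rational_points V" and near: "pdist (blowup_pt 1 1 1) P < 1 / 2"
  obtains x y z :: int where "x \<noteq> 0" "y \<noteq> 0" "z \<noteq> 0"
    "P = blowup_pt (of_int x) (of_int y) (of_int z)"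
proof -
  obtain P1 P2 P3 where "P = (P1, P2, P3)" "P1 \<in> rational_p1" "P2 \<in> rational_p1" "P3 \<in> rational_p1"
    using P unfolding rational_points_def by auto
  then obtain s1 t1 s2 t2 s3 t3 :: int where
    nz: "(s1, t1) \<noteq> (0, 0)" "(s2, t2) \<noteq> (0, 0)" "(s3, t3) \<noteq> (0, 0)" and
    eq: "P = (mk_p1 (of_int s1) (of_int t1), mk_p1 (of_int s2) (of_int t2), mk_p1 (of_int s3) (of_int t3))"
    by (metis rational_p1_int)
  have "P \<in> X3" using V P unfolding rational_points_def by auto
  then have "of_int s1 * of_int s2 * of_int s3 = (of_int t1 * of_int t2 * of_int t3 :: complex)"
    unfolding eq using nz by (subst (asm) mk_p1_in_X3_iff) auto
  then have rel: "s1 * s2 * s3 = t1 * t2 * t3" by (metis of_int_eq_iff of_int_mult)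
  have far: "chord (mk_p1 1 1) (mk_p1 (of_int s) (of_int t)) \<ge> 1 / 2"
    if "(s, t) \<noteq> (0, 0)" "s = 0 \<or> t = 0" for s t
    using chord_one_int_ge[OF that(1)] that by auto
  have "chord (mk_p1 1 1) (mk_p1 (of_int s1) (of_int t1)) +
      chord (mk_p1 1 1) (mk_p1 (of_int s2) (of_int t2)) +
      chord (mk_p1 1 1) (mk_p1 (of_int s3) (of_int t3)) < 1 / 2"
    using near by (simp add: pdist_def eq blowup_pt_def)
  then have nz': "s1 \<noteq> 0" "t1 \<noteq> 0" "s2 \<noteq> 0" "t2 \<noteq> 0"
    using far[OF nz(1)] far[OF nz(2)]
      chord_nonneg[of "mk_p1 1 1" "mk_p1 (of_int s1) (of_int t1)"]
      chord_nonneg[of "mk_p1 1 1" "mk_p1 (of_int s2) (of_int t2)"]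
      chord_nonneg[of "mk_p1 1 1" "mk_p1 (of_int s3) (of_int t3)"] by linarith+
  show thesis
  proof (rule that)
    have "t1 * t2 * t3 = s3 * (s1 * s2)" using rel by (simp add: mult_ac)
    then have rel': "of_int s3 * (of_int s1 * of_int s2) = (of_int t1 * of_int t2 * of_int t3 :: complex)"
      by (metis of_int_mult)
    \<comment> \<open>Clearing denominators in \<open>x / y = s1 / t1\<close> and
      \<open>y / z = s2 / t2\<close> gives these coordinates; the third ratio then agrees by the
      equation of \<open>X3\<close>.\<close>
    show "s1 * s2 \<noteq> 0" "t1 * s2 \<noteq> 0" "t1 * t2 \<noteq> 0" using nz' by auto
    show "P = blowup_pt (of_int (s1 * s2)) (of_int (t1 * s2)) (of_int (t1 * t2))"
      unfolding eq blowup_pt_def using nz nz' rel' by (auto simp: mk_p1_eq_iff mult_ac)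
  qed
qed

section \<open>Approximation along lines\<close>

text \<open>Some form defining the complement of \<open>U\<close> is nonzero at the parameter
  \<open>t\<close>, hence at all but finitely many parameters of the line. The point with integer
  coordinates \<open>n + p\<close>, \<open>n + q\<close>, \<open>n + r\<close> is \<open>n\<close>
  times the point of parameter \<open>1 / n\<close>. The given \<open>t\<close> is complex, since an
  open set is only known to contain complex points.\<close>

lemma eventually_line_point_in:
  fixes p q r :: int
  assumes U: "zariski_open U" and nc: "non_centre (1 + of_int p * t) (1 + of_int q * t) (1 + of_int r * t)"
    and tU: "blowup_pt (1 + of_int p * t) (1 + of_int q * t) (1 + of_int r * t) \<in> U"
  shows "\<forall>\<^sub>F n in sequentially.
    blowup_pt (of_int (int n + p)) (of_int (int n + q)) (of_int (int n + r)) \<in> U"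
proof -
  obtain T F where T: "T = X3 \<inter> (\<Inter>f\<in>F. zeros f)" "U = X3 - T"
    using U unfolding zariski_open_def zariski_closed_def by blast
  then obtain f where f: "f \<in> F" "blowup_pt (1 + of_int p * t) (1 + of_int q * t) (1 + of_int r * t) \<notin> zeros f"
    using tU by blast
  define Z where "Z = {t. eval_form f (1 + of_int p * t, 1 + of_int q * t)
    (1 + of_int q * t, 1 + of_int r * t) (1 + of_int r * t, 1 + of_int p * t) = 0}"
  have "finite Z"
    unfolding Z_def by (rule eval_form_affine_finite) (use f(2) nc blowup_pt_in_zeros_iff in blast)
  \<comment> \<open>At \<open>n = 0\<close> division by zero returns 0, a value taken at no other
    \<open>n\<close>.\<close>
  moreover have "inj (\<lambda>n :: nat. 1 / of_nat n :: complex)"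
    by (auto simp: inj_def)
  ultimately have "finite {n :: nat. 1 / of_nat n \<in> Z}"
    using finite_vimageI[of Z "\<lambda>n :: nat. 1 / of_nat n :: complex"] by (simp add: vimage_def)
  then have "\<forall>\<^sub>F n :: nat in sequentially. 1 / of_nat n \<notin> Z"
    unfolding cofinite_eq_sequentially[symmetric] eventually_cofinite by simp
  moreover have "\<forall>\<^sub>F n in sequentially. n > nat (\<bar>p\<bar> + \<bar>q\<bar> + \<bar>r\<bar>)"
    by (rule eventually_gt_at_top)
  ultimately show ?thesis
  proof eventually_elim
    case (elim n)
    have n: "(of_nat n :: complex) \<noteq> 0" using elim(2) by simp
    define s :: complex where "s = 1 / of_nat n"
    have "int n + p \<noteq> 0" "int n + q \<noteq> 0" "int n + r \<noteq> 0" using elim(2) by linarith+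
    then have "(of_int (int n + p) :: complex) \<noteq> 0" "(of_int (int n + q) :: complex) \<noteq> 0"
      "(of_int (int n + r) :: complex) \<noteq> 0"
      unfolding of_int_eq_0_iff .
    moreover have sc: "of_int (int n + k) = of_nat n * (1 + of_int k * s)" for k
      using n by (simp add: s_def field_simps)
    ultimately have ncs: "non_centre (1 + of_int p * s) (1 + of_int q * s) (1 + of_int r * s)"
      unfolding sc non_centre_def by auto
    have "blowup_pt (1 + of_int p * s) (1 + of_int q * s) (1 + of_int r * s) \<notin> zeros f"
      using elim(1) ncs blowup_pt_in_zeros_iff unfolding Z_def s_def by blast
    then show "blowup_pt (of_int (int n + p)) (of_int (int n + q)) (of_int (int n + r)) \<in> U"
      unfolding sc blowup_pt_scale[OF n ncs] T using f(1) blowup_pt_in_X3[OF ncs] by blast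
  qed
qed

text \<open>The exponent \<open>k\<close> counts the factors of the height that grow with
  \<open>n\<close>: three are allowed for on any line, two when a pair of coordinates
  coincides.\<close>

lemma approx_set_line:
  fixes p q r :: int and k :: nat
  assumes H: "anticanonical_height H" and ne: "\<not> (p = q \<and> q = r)"
    and k: "k = 3 \<or> k = 2 \<and> (p = q \<or> q = r \<or> r = p)"
    and ev: "\<forall>\<^sub>F n in sequentially.
      blowup_pt (of_int (int n + p)) (of_int (int n + q)) (of_int (int n + r)) \<in> V"
  shows "real k \<in> approx_set H (blowup_pt 1 1 1) V"
proof -
  define y where "y n = blowup_pt (of_int (int n + p)) (of_int (int n + q)) (of_int (int n + r))" for n
  define M where "M = \<bar>p\<bar> + \<bar>q\<bar> + \<bar>r\<bar>"
  obtain N0 where N0: "\<And>n. n \<ge> N0 \<Longrightarrow> y n \<in> V"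
    using ev unfolding eventually_sequentially y_def by blast
  \<comment> \<open>For \<open>n > 2 * M\<close> each of the three coordinates lies between
    \<open>n / 2\<close> and \<open>2 * n\<close>.\<close>
  define N where "N = N0 + nat (2 * M + 1)"
  have bounds: "y n \<in> rational_points V - {blowup_pt 1 1 1} \<and>
      pdist (blowup_pt 1 1 1) (y n) \<le> 12 * real_of_int M / real n \<and> H (y n) \<le> (2 * real n) ^ k"
    if n: "n \<ge> N" for n
  proof -
    define a where "a = int n + p"
    define b where "b = int n + q"
    define c where "c = int n + r"
    have y: "y n = blowup_pt (of_int a) (of_int b) (of_int c)"
      by (simp add: y_def a_def b_def c_def)
    have "int n > 2 * M" "M \<ge> 0" using n unfolding N_def M_def by linarith+
    then have M: "int n > 2 * M" "n > 0" by linarith+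
    have pqr: "- M \<le> p" "p \<le> M" "- M \<le> q" "q \<le> M" "- M \<le> r" "r \<le> M"
      unfolding M_def by auto
    then have pos: "2 * a \<ge> int n" "2 * b \<ge> int n" "2 * c \<ge> int n"
      using M(1) unfolding a_def b_def c_def by simp_all
    have a0: "a > 0" "b > 0" "c > 0" using pos M(2) by linarith+
    have le: "a \<le> 2 * int n" "b \<le> 2 * int n" "c \<le> 2 * int n"
      using M(1) pqr unfolding a_def b_def c_def by simp_all
    have df: "\<bar>a - b\<bar> \<le> 2 * M" "\<bar>b - c\<bar> \<le> 2 * M" "\<bar>c - a\<bar> \<le> 2 * M"
      using pqr unfolding a_def b_def c_def by simp_all
    have nc: "non_centre a b c"
      using a0 by (auto simp: non_centre_def)
    \<comment> \<open>The numerator is at most \<open>2 * M\<close> and the denominator at least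
      \<open>n / 2\<close>; three such chords give the constant 12.\<close>
    have ch: "chord (mk_p1 1 1) (mk_p1 (of_int s) (of_int t)) \<le> 4 * real_of_int M / real n"
      if st: "2 * s \<ge> int n" "\<bar>s - t\<bar> \<le> 2 * M" for s t
    proof -
      have s: "s > 0" using st M by linarith
      have "\<bar>real_of_int (s - t)\<bar> / real_of_int s \<le> (2 * real_of_int M) / (real n / 2)"
      proof (rule frac_le)
        show "\<bar>real_of_int (s - t)\<bar> \<le> 2 * real_of_int M" using st(2) by linarith
        show "real n / 2 \<le> real_of_int s" using st(1) by linarith
      qed (use M in \<open>auto simp: M_def\<close>)
      then show ?thesis using chord_one_int_le[OF s, of t] by simp
    qed
    have "pdist (blowup_pt 1 1 1) (y n) \<le> 4 * real_of_int M / real n + 4 * real_of_int M / real n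
        + 4 * real_of_int M / real n"
      unfolding y pdist_blowup using pos df by (intro add_mono ch) auto
    moreover have "y n \<in> rational_points V"
    proof -
      have "mk_p1 (of_int s) (of_int t) \<in> rational_p1" if "s \<noteq> 0" for s t
        unfolding rational_p1_def mem_Collect_eq
        by (rule exI[of _ "of_int s"], rule exI[of _ "of_int t"]) (use that in auto)
      then show ?thesis
        using N0[of n] n a0 unfolding rational_points_def y blowup_pt_def N_def by auto
    qed
    moreover have "y n \<noteq> blowup_pt 1 1 1"
    proof
      assume "y n = blowup_pt 1 1 1"
      then have "mk_p1 (of_int a) (of_int b) = mk_p1 1 1" "mk_p1 (of_int b) (of_int c) = mk_p1 1 1"
        unfolding y blowup_pt_def by blast+
      then have "a = b \<and> b = c"
        using a0 by (simp add: mk_p1_eq_iff)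
      then show False using ne unfolding a_def b_def c_def by simp
    qed
    moreover have "H (y n) \<le> (2 * real n) ^ k"
    proof -
      have h: "p1_height s t \<le> 2 * real n"
        if "s > 0" "t > 0" "s \<le> 2 * int n" "t \<le> 2 * int n" for s t
      proof -
        have "p1_height s t \<le> real_of_int (max \<bar>s\<bar> \<bar>t\<bar>)" using that by (intro p1_height_le) auto
        also have "\<dots> \<le> 2 * real n" using that by linarith
        finally show ?thesis .
      qed
      have hs: "p1_height a b \<le> 2 * real n" "p1_height b c \<le> 2 * real n" "p1_height c a \<le> 2 * real n"
        using h a0 le by auto
      have h0: "p1_height a b \<ge> 0" "p1_height b c \<ge> 0" "p1_height c a \<ge> 0"
        using p1_height_ge_1[of a b] p1_height_ge_1[of b c] p1_height_ge_1[of c a] a0 by auto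
      have H: "H (y n) = p1_height a b * p1_height b c * p1_height c a"
        unfolding y by (rule anticanonical_height_eq[OF H nc])
      consider "k = 3" | "k = 2" "a = b" | "k = 2" "b = c" | "k = 2" "c = a"
        using k unfolding a_def b_def c_def by auto
      then show ?thesis
      proof cases
        case 1
        then show ?thesis unfolding H 1 power3_eq_cube using hs h0 by (intro mult_mono) auto
      next
        case 2
        then have Hk: "H (y n) = p1_height b c * p1_height c a" using H a0 by (simp add: p1_height_diag)
        show ?thesis unfolding 2(1) Hk power2_eq_square using hs h0 by (intro mult_mono) auto
      next
        case 3
        then have Hk: "H (y n) = p1_height a b * p1_height c a" using H a0 by (simp add: p1_height_diag)
        show ?thesis unfolding 3(1) Hk power2_eq_square using hs h0 by (intro mult_mono) auto
      next
        case 4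
        then have Hk: "H (y n) = p1_height a b * p1_height b c" using H a0 by (simp add: p1_height_diag)
        show ?thesis unfolding 4(1) Hk power2_eq_square using hs h0 by (intro mult_mono) auto
      qed
    qed
    ultimately show ?thesis by simp
  qed
  have N1: "n > 0" if "n \<ge> N" for n using that by (simp add: N_def M_def)
  \<comment> \<open>The bounds \<open>12 * M / n\<close> and \<open>2 * n\<close> multiply to
    \<open>24 * M\<close>; adding 1 makes the inequality strict.\<close>
  define C where "C = (24 * real_of_int M) ^ k + 1"
  have "\<forall>\<^sub>F n in sequentially. 0 \<le> pdist (blowup_pt 1 1 1) (y n)"
    by (simp add: pdist_nonneg)
  moreover have "\<forall>\<^sub>F n in sequentially. pdist (blowup_pt 1 1 1) (y n) \<le> 12 * real_of_int M / real n"
    using bounds unfolding eventually_sequentially by blast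
  ultimately have lim: "(\<lambda>n. pdist (blowup_pt 1 1 1) (y n)) \<longlonglongrightarrow> 0"
    using tendsto_const lim_const_over_n by (rule tendsto_sandwich)
  have small: "pdist (blowup_pt 1 1 1) (y n) powr real k * H (y n) < C" if n: "n \<ge> N" for n
  proof -
    \<comment> \<open>Since \<open>0 powr 0\<close> is 0 but \<open>0 ^ 0\<close> is 1, passing from
      \<open>powr\<close> to \<open>^\<close> for a distance only known to be nonnegative requires a
      nonzero exponent.\<close>
    have "k \<noteq> 0" using k by auto
    then have "pdist (blowup_pt 1 1 1) (y n) powr real k * H (y n) =
        pdist (blowup_pt 1 1 1) (y n) ^ k * H (y n)"
      by (simp add: powr_realpow' pdist_nonneg)
    also have "\<dots> \<le> pdist (blowup_pt 1 1 1) (y n) ^ k * (2 * real n) ^ k"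
      using bounds[OF n] by (intro mult_left_mono) (auto simp: pdist_nonneg)
    also have "\<dots> \<le> (12 * real_of_int M / real n) ^ k * (2 * real n) ^ k"
      using bounds[OF n] by (intro mult_right_mono power_mono) (auto simp: pdist_nonneg)
    also have "\<dots> = (24 * real_of_int M) ^ k"
      using N1[OF n] unfolding power_mult_distrib[symmetric] by simp
    finally show ?thesis by (simp add: C_def)
  qed
  show ?thesis
    unfolding approx_set_def
  proof (intro CollectI conjI exI)
    show "real k > 0" using k by auto
    show "C > 0" unfolding C_def M_def by (simp add: add_nonneg_pos)
    show "\<forall>i. y (i + N) \<in> rational_points V - {blowup_pt 1 1 1}" using bounds by simp
    show "(\<lambda>i. pdist (blowup_pt 1 1 1) (y (i + N))) \<longlonglongrightarrow> 0" using lim by (rule LIMSEQ_ignore_initial_segment)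
    show "\<forall>i. pdist (blowup_pt 1 1 1) (y (i + N)) powr real k * H (y (i + N)) < C" using small by simp
  qed
qed

text \<open>Combining the lower bound 1/8 for \<open>d ^ 3 * H\<close> with the upper bound
  \<open>C\<close> for \<open>d powr \<gamma> * H\<close> bounds
  \<open>C * d powr (3 - \<gamma>)\<close> below by 1/8. For \<gamma> below 3 this contradicts the
  distances tending to 0.\<close>

lemma approx_set_ge:
  assumes H: "anticanonical_height H" and V: "V \<subseteq> X3"
    and off: "\<And>x y z :: int. blowup_pt (of_int x) (of_int y) (of_int z) \<in> V \<Longrightarrow>
      x \<noteq> 0 \<Longrightarrow> y \<noteq> 0 \<Longrightarrow> z \<noteq> 0 \<Longrightarrow> x \<noteq> y \<and> y \<noteq> z \<and> z \<noteq> x"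
    and g: "\<gamma> \<in> approx_set H (blowup_pt 1 1 1) V"
  shows "\<gamma> \<ge> 3"
proof (rule ccontr)
  assume "\<not> \<gamma> \<ge> 3"
  obtain C y where C: "C > 0" and y: "\<And>i. y i \<in> rational_points V" and
    lim: "(\<lambda>i. pdist (blowup_pt 1 1 1) (y i)) \<longlonglongrightarrow> 0" and
    bd: "\<And>i. pdist (blowup_pt 1 1 1) (y i) powr \<gamma> * H (y i) < C"
    using g unfolding approx_set_def by auto
  define d where "d i = pdist (blowup_pt 1 1 1) (y i)" for i
  have near: "\<forall>\<^sub>F i in sequentially. d i < 1 / 2"
    using order_tendstoD(2)[OF lim, of "1 / 2"] unfolding d_def by simp
  have low: "d i > 0 \<and> 1 / 8 \<le> C * d i powr (3 - \<gamma>)" if i: "d i < 1 / 2" for i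
  proof -
    obtain a b c :: int where nz: "a \<noteq> 0" "b \<noteq> 0" "c \<noteq> 0" and
      eq: "y i = blowup_pt (of_int a) (of_int b) (of_int c)"
      using near_point_int[OF V y] i unfolding d_def by metis
    have "y i \<in> V" using y[of i] unfolding rational_points_def by blast
    then have ne: "a \<noteq> b" "b \<noteq> c" "c \<noteq> a" using off nz unfolding eq by auto
    have low: "1 / 8 \<le> d i ^ 3 * H (y i)"
      unfolding d_def eq using H ne by (rule pdist_height_ge)
    have "d i \<ge> 0" unfolding d_def by (rule pdist_nonneg)
    \<comment> \<open>Distance 0 would make the product in \<open>low\<close> vanish.\<close>
    then have d: "d i > 0" using low by (cases "d i = 0") auto
    have "d i ^ 3 = d i powr (3 - \<gamma>) * d i powr \<gamma>"
      using d by (simp flip: powr_add)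
    then have "1 / 8 \<le> d i powr (3 - \<gamma>) * (d i powr \<gamma> * H (y i))"
      using low by (simp add: mult_ac)
    also have "\<dots> \<le> d i powr (3 - \<gamma>) * C"
      using bd[of i] unfolding d_def[symmetric] by (intro mult_left_mono) auto
    finally show ?thesis using d by (simp add: mult.commute)
  qed
  have "(\<lambda>i. d i powr (3 - \<gamma>)) \<longlonglongrightarrow> 0"
    using lim \<open>\<not> \<gamma> \<ge> 3\<close> unfolding d_def[symmetric]
    by (intro tendsto_zero_powrI[where b = "3 - \<gamma>"] eventually_mono[OF near])
      (use low in \<open>auto simp: less_imp_le\<close>)
  then have "(\<lambda>i. C * d i powr (3 - \<gamma>)) \<longlonglongrightarrow> 0"
    by (rule tendsto_mult_right_zero)
  then have "\<forall>\<^sub>F i in sequentially. C * d i powr (3 - \<gamma>) < 1 / 8"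
    by (rule order_tendstoD) simp
  with near have "\<forall>\<^sub>F i in sequentially. False"
    by eventually_elim (use low in force)
  then show False by simp
qed

section \<open>The essential constant\<close>

text \<open>Shows that an open set with a nonempty approximation set takes part in the supremum
  defining \<open>ess_approx_const\<close>.\<close>

lemma INF_pdist_eq_0:
  assumes "\<gamma> \<in> approx_set H Q V"
  shows "(INF y\<in>rational_points V. ereal (pdist Q y)) = 0"
proof (rule antisym)
  obtain y where y: "\<And>i. y i \<in> rational_points V" and lim: "(\<lambda>i. pdist Q (y i)) \<longlonglongrightarrow> 0"
    using assms unfolding approx_set_def by auto
  have "(\<lambda>i. ereal (pdist Q (y i))) \<longlonglongrightarrow> ereal 0"
    using lim by (rule tendsto_ereal)
  then have "(INF y\<in>rational_points V. ereal (pdist Q y)) \<le> ereal 0"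
    by (rule LIMSEQ_le_const) (use y in \<open>auto intro: INF_lower\<close>)
  then show "(INF y\<in>rational_points V. ereal (pdist Q y)) \<le> 0"
    by (simp add: zero_ereal_def)
qed (auto intro!: INF_greatest simp: pdist_nonneg)

lemma approx_const_le: "\<gamma> \<in> approx_set H Q V \<Longrightarrow> approx_const H Q V \<le> ereal \<gamma>"
  unfolding approx_const_def by (rule INF_lower)

text \<open>Gives the upper bound for the essential constant: a single rational point of
  \<open>V\<close> near the base point already determines a line through the base point that meets
  \<open>V\<close>.\<close>

lemma three_in_approx_set_open:
  assumes H: "anticanonical_height H" and V: "zariski_open V"
    and inf: "(INF y\<in>rational_points V. ereal (pdist (blowup_pt 1 1 1) y)) = 0"
  shows "3 \<in> approx_set H (blowup_pt 1 1 1) V"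
proof -
  have VX: "V \<subseteq> X3" using V unfolding zariski_open_def by blast
  have "(INF y\<in>rational_points V. ereal (pdist (blowup_pt 1 1 1) y)) < ereal (1 / 2)"
    unfolding inf by simp
  then obtain P where P: "P \<in> rational_points V" "pdist (blowup_pt 1 1 1) P < 1 / 2"
    unfolding INF_less_iff by auto
  obtain x y z :: int where nz: "x \<noteq> 0" "y \<noteq> 0" "z \<noteq> 0" and
    eq: "P = blowup_pt (of_int x) (of_int y) (of_int z)"
    by (rule near_point_int[OF VX P])
  have PV: "P \<in> V" using P unfolding rational_points_def by blast
  have "\<exists>p q r :: int. \<exists>t :: complex. \<not> (p = q \<and> q = r) \<and>
      non_centre (1 + of_int p * t) (1 + of_int q * t) (1 + of_int r * t) \<and>
      blowup_pt (1 + of_int p * t) (1 + of_int q * t) (1 + of_int r * t) \<in> V"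
  proof (cases "x = y \<and> y = z")
    case True
    then have "P = blowup_pt 1 1 1"
      using nz mk_p1_diag[of "of_int x"] unfolding eq by (simp add: blowup_pt_def)
    \<comment> \<open>If the point found is the base point, it sits at \<open>t = 0\<close> on every
      line through it; \<open>p\<close>, \<open>q\<close>, \<open>r\<close> only have to be not all
      equal.\<close>
    then show ?thesis
      using PV by (intro exI[of _ 0] exI[of _ 1]) (simp add: non_centre_def)
  next
    case False
    \<comment> \<open>The line joining [1:1:1] to [x:y:z] passes through the latter at
      \<open>t = 1\<close>.\<close>
    then show ?thesis
      using PV nz unfolding eq
      by (intro exI[of _ "x - 1"] exI[of _ "y - 1"] exI[of _ "z - 1"] exI[of _ 1])
        (auto simp: non_centre_def)
  qed
  then obtain p q r :: int and t :: complex where ne: "\<not> (p = q \<and> q = r)" and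
    nc: "non_centre (1 + of_int p * t) (1 + of_int q * t) (1 + of_int r * t)" and
    inV: "blowup_pt (1 + of_int p * t) (1 + of_int q * t) (1 + of_int r * t) \<in> V"
    by blast
  show ?thesis
    using approx_set_line[OF H ne _ eventually_line_point_in[OF V nc inV], of 3] by simp
qed

text \<open>If \<open>U\<close> missed all these points, its complement would be a closed set
  containing them, hence the whole closure and \<open>P\<close>. This replaces a point possibly on
  an exceptional divisor by one with plane coordinates.\<close>

lemma strict_transform_open_meets:
  assumes P: "P \<in> strict_transform C" and U: "zariski_open U" "P \<in> U"
  obtains x y z where "non_centre x y z" "C x y z" "blowup_pt x y z \<in> U"
proof -
  obtain T where T: "zariski_closed T" "U = X3 - T"
    using U unfolding zariski_open_def by blast
  have "\<not> {blowup_pt x y z | x y z. non_centre x y z \<and> C x y z} \<subseteq> T"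
    using closure_minimal[OF T(1)] P U(2) T(2) unfolding strict_transform_def by blast
  then obtain x y z where "non_centre x y z" "C x y z" "blowup_pt x y z \<notin> T"
    by blast
  then show thesis
    using that blowup_pt_in_X3 T(2) by blast
qed

text \<open>Treats the three curves uniformly: \<open>C\<close> is a line through [1:1:1] in
  direction \<open>(p, q, r)\<close>, and the hypothesis on \<open>C\<close> writes each of its
  points off the centres in the affine parameter \<open>t\<close>. A complex point of the curve in
  \<open>U\<close> thus yields integer points of the curve in \<open>U\<close>.\<close>

lemma two_in_approx_set_strict_transform:
  fixes p q r :: int
  assumes H: "anticanonical_height H" and U: "zariski_open U"
    and C: "\<And>x y z. C x y z \<Longrightarrow> non_centre x y z \<Longrightarrow>
      \<exists>k t. k \<noteq> 0 \<and> x = k * (1 + of_int p * t) \<and> y = k * (1 + of_int q * t) \<and> z = k * (1 + of_int r * t)"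
    and pqr: "\<not> (p = q \<and> q = r)" "p = q \<or> q = r \<or> r = p"
    and onC: "\<And>n :: int. C (of_int (n + p)) (of_int (n + q)) (of_int (n + r))"
    and P: "P \<in> strict_transform C" "P \<in> U" and Z: "strict_transform C \<subseteq> Z"
  shows "2 \<in> approx_set H (blowup_pt 1 1 1) (Z \<inter> U)"
proof -
  obtain x y z where xyz: "non_centre x y z" "C x y z" "blowup_pt x y z \<in> U"
    using strict_transform_open_meets[OF P(1) U P(2)] .
  obtain k t where k: "k \<noteq> 0" and eq: "x = k * (1 + of_int p * t)" "y = k * (1 + of_int q * t)"
    "z = k * (1 + of_int r * t)"
    using C[OF xyz(2,1)] by blast
  have nc: "non_centre (1 + of_int p * t) (1 + of_int q * t) (1 + of_int r * t)"
    using xyz(1) k unfolding eq by (auto simp: non_centre_def)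
  have "blowup_pt (1 + of_int p * t) (1 + of_int q * t) (1 + of_int r * t) \<in> U"
    using xyz(3) unfolding eq blowup_pt_scale[OF k nc] .
  from eventually_line_point_in[OF U nc this] eventually_gt_at_top[of "nat (\<bar>p\<bar> + \<bar>q\<bar> + \<bar>r\<bar>)"]
  have "\<forall>\<^sub>F n in sequentially.
      blowup_pt (of_int (int n + p)) (of_int (int n + q)) (of_int (int n + r)) \<in> Z \<inter> U"
  proof eventually_elim
    case (elim n)
    have "int n + p \<noteq> 0" "int n + q \<noteq> 0" "int n + r \<noteq> 0" using elim(2) by linarith+
    then have "(of_int (int n + p) :: complex) \<noteq> 0" "(of_int (int n + q) :: complex) \<noteq> 0"
      "(of_int (int n + r) :: complex) \<noteq> 0"
      unfolding of_int_eq_0_iff .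
    then have "non_centre (of_int (int n + p) :: complex) (of_int (int n + q)) (of_int (int n + r))"
      unfolding non_centre_def by auto
    then show ?case
      using elim(1) Z blowup_pt_in_strict_transform[of _ _ _ C, OF _ onC] by blast
  qed
  then show ?thesis
    using approx_set_line[OF H pqr(1), of 2] pqr(2) by simp
qed

theorem mainTheorem1:
  fixes H :: "point \<Rightarrow> real" and Q :: point and Z :: "point set"
  assumes H: "anticanonical_height H"
    and Q: "Q = blowup_pt 1 1 1"
    and Z: "Z = strict_transform (\<lambda>x y z. x = y) \<union> strict_transform (\<lambda>x y z. y = z) \<union>
                strict_transform (\<lambda>x y z. x = z)"
  shows "3 \<in> approx_set H Q (X3 - Z) \<and> approx_const H Q (X3 - Z) = 3 \<and>
         ess_approx_const H Q = 3 \<and> maximal_locally_accumulating H Q Z"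
proof -
  have Zeq: "Z = X3 \<inter> zeros diagonal_form"
    unfolding Z by (rule strict_transforms_eq_zeros)
  have Zcl: "zariski_closed Z"
    unfolding Zeq by (rule zariski_closed_zeros)
  have op: "zariski_open (X3 - Z)"
    using Zcl unfolding zariski_open_def by blast
  have inZ: "blowup_pt x y z \<in> Z \<longleftrightarrow> x = y \<or> y = z \<or> z = x" if "non_centre x y z" for x y z
    using that unfolding Zeq by (auto simp: blowup_pt_in_X3 blowup_pt_in_zeros_iff eval_diagonal_form)

  have three: "3 \<in> approx_set H Q (X3 - Z)"
  proof -
    \<comment> \<open>The point [1:2:3] has distinct coordinates and so lies off \<open>Z\<close>;
      the line used joins it to [1:1:1].\<close>
    have nc: "non_centre (1 + of_int 0 * 1 :: complex) (1 + of_int 1 * 1) (1 + of_int 2 * 1)"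
      by (simp add: non_centre_def)
    have "blowup_pt (1 + of_int 0 * 1) (1 + of_int 1 * 1) (1 + of_int 2 * 1) \<in> X3 - Z"
      using blowup_pt_in_X3[OF nc] inZ[OF nc] by simp
    from approx_set_line[OF H _ _ eventually_line_point_in[OF op nc this], of 3]
    show ?thesis unfolding Q by simp
  qed
  have "3 \<le> \<gamma>" if "\<gamma> \<in> approx_set H Q (X3 - Z)" for \<gamma>
  proof (rule approx_set_ge[OF H _ _ that[unfolded Q]])
    fix x y z :: int
    assume "blowup_pt (of_int x) (of_int y) (of_int z) \<in> X3 - Z" "x \<noteq> 0" "y \<noteq> 0" "z \<noteq> 0"
    then show "x \<noteq> y \<and> y \<noteq> z \<and> z \<noteq> x"
      using inZ[of "of_int x" "of_int y" "of_int z"] by (auto simp: non_centre_def)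
  qed blast
  then have "approx_const H Q (X3 - Z) \<ge> 3"
    unfolding approx_const_def by (intro INF_greatest) simp
  with approx_const_le[OF three] have const: "approx_const H Q (X3 - Z) = 3"
    by simp

  have ess: "ess_approx_const H Q = 3"
  proof (rule antisym)
    show "ess_approx_const H Q \<le> 3"
      unfolding ess_approx_const_def
    proof (rule SUP_least)
      fix V assume "V \<in> {V. zariski_open V \<and> (INF y\<in>rational_points V. ereal (pdist Q y)) = 0}"
      then have "3 \<in> approx_set H Q V"
        using three_in_approx_set_open[OF H] unfolding Q by blast
      then show "approx_const H Q V \<le> 3"
        using approx_const_le by fastforce
    qed
    show "3 \<le> ess_approx_const H Q"
      unfolding ess_approx_const_def const[symmetric]
      \<comment> \<open>The complement of \<open>Z\<close> is itself one of the open sets in the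
        supremum.\<close>
      by (rule SUP_upper) (use op INF_pdist_eq_0[OF three] in simp)
  qed

  have acc: "approx_const H Q W < ess_approx_const H Q" if W: "zariski_open_in Z W" "W \<noteq> {}" for W
  proof -
    obtain U P where U: "zariski_open U" "W = Z \<inter> U" and P: "P \<in> Z" "P \<in> U"
      using W unfolding zariski_open_in_def by blast
    from P(1) consider "P \<in> strict_transform (\<lambda>x y z. x = y)" |
      "P \<in> strict_transform (\<lambda>x y z. y = z)" | "P \<in> strict_transform (\<lambda>x y z. x = z)"
      unfolding Z by blast
    then have "2 \<in> approx_set H Q (Z \<inter> U)"
    proof cases
      case 1
      show ?thesis unfolding Q
      \<comment> \<open>The direction [0:0:1] is the only point of the line missed by the parameter
        \<open>t\<close>, and it is a blown-up centre. Elsewhere \<open>x\<close> is nonzero and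
        serves as \<open>k\<close>. The other two lines are analogous.\<close>
      proof (rule two_in_approx_set_strict_transform[OF H U(1) _ _ _ _ 1 P(2), where p = 0 and q = 0 and r = 1])
        show "\<exists>k t. k \<noteq> 0 \<and> x = k * (1 + of_int 0 * t) \<and> y = k * (1 + of_int 0 * t) \<and>
            z = k * (1 + of_int 1 * t)" if "x = y" "non_centre x y z" for x y z :: complex
          using that by (intro exI[of _ x] exI[of _ "z / x - 1"]) (auto simp: non_centre_def)
      qed (auto simp: Z)
    next
      case 2
      show ?thesis unfolding Q
      proof (rule two_in_approx_set_strict_transform[OF H U(1) _ _ _ _ 2 P(2), where p = 1 and q = 0 and r = 0])
        show "\<exists>k t. k \<noteq> 0 \<and> x = k * (1 + of_int 1 * t) \<and> y = k * (1 + of_int 0 * t) \<and>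
            z = k * (1 + of_int 0 * t)" if "y = z" "non_centre x y z" for x y z :: complex
          using that by (intro exI[of _ y] exI[of _ "x / y - 1"]) (auto simp: non_centre_def)
      qed (auto simp: Z)
    next
      case 3
      show ?thesis unfolding Q
      proof (rule two_in_approx_set_strict_transform[OF H U(1) _ _ _ _ 3 P(2), where p = 0 and q = 1 and r = 0])
        show "\<exists>k t. k \<noteq> 0 \<and> x = k * (1 + of_int 0 * t) \<and> y = k * (1 + of_int 1 * t) \<and>
            z = k * (1 + of_int 0 * t)" if "x = z" "non_centre x y z" for x y z :: complex
          using that by (intro exI[of _ x] exI[of _ "y / x - 1"]) (auto simp: non_centre_def)
      qed (auto simp: Z)
    qed
    then have "approx_const H Q W \<le> ereal 2"
      unfolding U(2) by (rule approx_const_le)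
    also have "ereal 2 < ess_approx_const H Q"
      unfolding ess by simp
    finally show ?thesis .
  qed
  have "Q \<in> Z"
    unfolding Q by (subst inZ) (auto simp: non_centre_def)
  with Zcl acc const ess three show ?thesis
    unfolding maximal_locally_accumulating_def locally_accumulating_def by auto
qed

end
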